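(* Let $R,T,D,S\in\mathbb Q[x,q,p,z]$ be the explicit polynomials defined in the context. Then the $\mathbb C$-algebra homomorphism $$\Phi:\mathcal P_2\to\mathcal P_2,\qquad \Phi(x)=R,\quad \Phi(q)=T,\quad \Phi(p)=D,\quad \Phi(z)=S,$$ is a Poisson endomorphism of $\mathcal P_2=\mathbb C[x,q,p,z]$ but not an automorphism. Its associated point map $\Phi_{\mathrm{pt}}=(R,T,D,S):\mathbb A^4_{\mathbb C}\to\mathbb A^4_{\mathbb C}$, $(x,q,p,z)\mapsto (R,T,D,S)$, satisfies $\det J\Phi_{\mathrm{pt}}=1$, and the fiber of $\Phi_{\mathrm{pt}}$ over $(R,T,D,S)=(0,1/8,0,0)$ consists exactly of the three points $$\left(0,0,\tfrac1{24},-\tfrac18\right),\qquad \left(1,\tfrac23,\tfrac{247}{96},-\tfrac{89}{64}\right),\qquad \left(-1,-\tfrac23,\tfrac{247}{96},-\tfrac{89}{64}\right)$$ (in the coordinates $(x,q,p,z)$). Consequently, the Poisson Conjecture $\mathrm{PC}(2)$ is false.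
   Context: $\mathcal P_2=\mathbb C[x,q,p,z]$ carries the canonical Poisson bracket $$\{f,g\}=f_p g_x-f_x g_p+f_z g_q-f_q g_z,$$ so $\{p,x\}=\{z,q\}=1$ and the other brackets between distinct generators vanish. A Poisson endomorphism of $\mathcal P_2$ is a $\mathbb C$-algebra endomorphism $\Phi$ with $\Phi(\{f,g\})=\{\Phi(f),\Phi(g)\}$ for all $f,g$. $\mathrm{PC}(2)$ is the assertion that every Poisson endomorphism of $\mathcal P_2$ is an automorphism. $J F$ denotes the Jacobian matrix of a polynomial map $F$ with respect to $(x,q,p,z)$. Define polynomials in $\mathbb Q[x,q,p,z]$ as follows: $$a=1-3xq,\qquad B=3x^2p+2az,\qquad \beta=B-9q^2,\qquad y=q-\frac{x\beta}{3},\qquad u=xy,$$ $$R=2x-3x^2y-x^3\beta,$$ $$S=y+3x(1+u)^2\beta+3xy^2(4+3u),$$ $$T=-\frac12\left((1+u)^3\beta+y^2(1+u)(4+3u)\right),$$ $$D_0=\frac{1+3xq}{2}\,p-3q^2z,$$ $$H=\frac{y^4}{20}(18u^2+78u+125)+\frac{3\beta y^2}{10}(u^3+5u^2+10u-5)-\frac{\beta^2}{6}(9u+2)-\frac{x^2\beta^3}{6},$$ $$D=D_0+H.$$ *)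

theory Defs
  imports "HOL-Analysis.Analysis" "HOL-Library.Poly_Mapping"
begin

section \<open>The polynomial ring \<open>\<complex>[x,q,p,z]\<close>\<close>

datatype coord = X | Q | P | Z

instance coord :: finite
proof
  have "(UNIV :: coord set) = {X, Q, P, Z}"
    using coord.exhaust by blast
  then show "finite (UNIV :: coord set)"
    by (metis finite.emptyI finite.insertI)
qed

text \<open>A polynomial maps a monomial (its exponent vector) to its coefficient; the
  commutative ring structure is the convolution structure of \<open>Poly_Mapping\<close>.\<close>

type_synonym P2 = "(coord \<Rightarrow>\<^sub>0 nat) \<Rightarrow>\<^sub>0 complex"

definition Const :: "complex \<Rightarrow> P2" where
  "Const c = Poly_Mapping.single 0 c"

definition Var :: "coord \<Rightarrow> P2" where
  "Var v = Poly_Mapping.single (Poly_Mapping.single v 1) 1"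

text \<open>Tuples indexed by the coordinates in the order \<open>(x,q,p,z)\<close>, used both for points of
  affine 4-space and for 4-tuples of polynomials.\<close>

definition tuple :: "'a \<Rightarrow> 'a \<Rightarrow> 'a \<Rightarrow> 'a \<Rightarrow> 'a ^ coord" where
  "tuple a b c d = (\<chi> v. case v of X \<Rightarrow> a | Q \<Rightarrow> b | P \<Rightarrow> c | Z \<Rightarrow> d)"

text \<open>Substitution of \<open>F $ v\<close> for the variable \<open>v\<close>, with coefficients transported by \<open>h\<close>.\<close>

definition substitute :: "(complex \<Rightarrow> 'b::comm_ring_1) \<Rightarrow> 'b ^ coord \<Rightarrow> P2 \<Rightarrow> 'b" where
  "substitute h F f =
     (\<Sum>m\<in>Poly_Mapping.keys f.
        h (Poly_Mapping.lookup f m) * (\<Prod>v\<in>UNIV. (F $ v) ^ Poly_Mapping.lookup m v))"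

abbreviation eval_at :: "complex ^ coord \<Rightarrow> P2 \<Rightarrow> complex" where
  "eval_at \<equiv> substitute (\<lambda>c. c)"

abbreviation subst_hom :: "P2 ^ coord \<Rightarrow> P2 \<Rightarrow> P2" where
  "subst_hom \<equiv> substitute Const"

text \<open>If \<open>v\<close> does not occur in \<open>m\<close>, the truncated exponent subtraction is harmless, since the
  coefficient is then multiplied by \<open>0\<close>.\<close>

definition partial :: "coord \<Rightarrow> P2 \<Rightarrow> P2" where
  "partial v f =
     (\<Sum>m\<in>Poly_Mapping.keys f.
        Poly_Mapping.single (m - Poly_Mapping.single v 1)
          (of_nat (Poly_Mapping.lookup m v) * Poly_Mapping.lookup f m))"


section \<open>Poisson endomorphisms and the Poisson Conjecture\<close>

definition pbracket :: "P2 \<Rightarrow> P2 \<Rightarrow> P2" where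
  "pbracket f g =
     partial P f * partial X g - partial X f * partial P g
     + partial Z f * partial Q g - partial Q f * partial Z g"

definition algebra_endo :: "(P2 \<Rightarrow> P2) \<Rightarrow> bool" where
  "algebra_endo \<Phi> \<longleftrightarrow>
     (\<forall>f g. \<Phi> (f + g) = \<Phi> f + \<Phi> g) \<and>
     (\<forall>f g. \<Phi> (f * g) = \<Phi> f * \<Phi> g) \<and>
     (\<forall>c. \<Phi> (Const c) = Const c)"

definition poisson_endo :: "(P2 \<Rightarrow> P2) \<Rightarrow> bool" where
  "poisson_endo \<Phi> \<longleftrightarrow>
     algebra_endo \<Phi> \<and> (\<forall>f g. \<Phi> (pbracket f g) = pbracket (\<Phi> f) (\<Phi> g))"

definition algebra_auto :: "(P2 \<Rightarrow> P2) \<Rightarrow> bool" where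
  "algebra_auto \<Phi> \<longleftrightarrow> algebra_endo \<Phi> \<and> bij \<Phi>"

text \<open>The inverse of a bijective Poisson endomorphism is again Poisson, so there is no
  difference between algebra and Poisson automorphisms here.\<close>

definition PC2 :: bool where
  "PC2 \<longleftrightarrow> (\<forall>\<Phi>. poisson_endo \<Phi> \<longrightarrow> algebra_auto \<Phi>)"


section \<open>Polynomial maps of affine 4-space\<close>

definition point_map :: "P2 ^ coord \<Rightarrow> complex ^ coord \<Rightarrow> complex ^ coord" where
  "point_map F a = (\<chi> v. eval_at a (F $ v))"

definition jacobian_matrix :: "P2 ^ coord \<Rightarrow> P2 ^ coord ^ coord" where
  "jacobian_matrix F = (\<chi> i j. partial j (F $ i))"


section \<open>The explicit polynomials\<close>

abbreviation "xv \<equiv> Var X"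
abbreviation "qv \<equiv> Var Q"
abbreviation "pv \<equiv> Var P"
abbreviation "zv \<equiv> Var Z"

definition a_poly :: P2 where
  "a_poly = 1 - 3 * xv * qv"

definition B_poly :: P2 where
  "B_poly = 3 * xv^2 * pv + 2 * a_poly * zv"

definition beta_poly :: P2 where
  "beta_poly = B_poly - 9 * qv^2"

definition y_poly :: P2 where
  "y_poly = qv - Const (1/3) * xv * beta_poly"

definition u_poly :: P2 where
  "u_poly = xv * y_poly"

definition R_poly :: P2 where
  "R_poly = 2 * xv - 3 * xv^2 * y_poly - xv^3 * beta_poly"

definition S_poly :: P2 where
  "S_poly = y_poly + 3 * xv * (1 + u_poly)^2 * beta_poly + 3 * xv * y_poly^2 * (4 + 3 * u_poly)"

definition T_poly :: P2 where
  "T_poly = - Const (1/2) * ((1 + u_poly)^3 * beta_poly + y_poly^2 * (1 + u_poly) * (4 + 3 * u_poly))"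

definition D0_poly :: P2 where
  "D0_poly = Const (1/2) * (1 + 3 * xv * qv) * pv - 3 * qv^2 * zv"

definition H_poly :: P2 where
  "H_poly = Const (1/20) * y_poly^4 * (18 * u_poly^2 + 78 * u_poly + 125)
      + Const (3/10) * beta_poly * y_poly^2 * (u_poly^3 + 5 * u_poly^2 + 10 * u_poly - 5)
      - Const (1/6) * beta_poly^2 * (9 * u_poly + 2)
      - Const (1/6) * xv^2 * beta_poly^3"

definition D_poly :: P2 where
  "D_poly = D0_poly + H_poly"

text \<open>The tuple lists the images of \<open>x, q, p, z\<close> in this order.\<close>

definition Phi_tuple :: "P2 ^ coord" where
  "Phi_tuple = tuple R_poly T_poly D_poly S_poly"

definition Phi :: "P2 \<Rightarrow> P2" where
  "Phi = subst_hom Phi_tuple"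

end

theory Submission
  imports Defs
begin

text \<open>The elements \<open>x\<close>, \<open>y\<close>, \<open>\<beta>\<close> have brackets that are polynomials in \<open>x\<close>, \<open>y\<close>, \<open>\<beta>\<close>, and so do
  their brackets with \<open>D\<^sub>0\<close>. Since \<open>R\<close>, \<open>S\<close>, \<open>T\<close>, \<open>H\<close> are polynomials in \<open>x\<close>, \<open>y\<close>, \<open>\<beta>\<close>, the
  chain rule reduces the canonical relations between \<open>R, T, D, S\<close> to identities in
  \<open>\<int>[x, y, \<beta>]\<close>. The Jacobian determinant is then read off as a Pfaffian of brackets, and a
  surjective \<open>\<Phi>\<close> would have an injective point map, contradicting the three-point fibre.\<close>

section \<open>Substitution homomorphisms\<close>

lemma Const_0 [simp]: "Const 0 = 0"
  and Const_1 [simp]: "Const 1 = 1"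
  and Const_numeral [simp]: "Const (numeral k) = numeral k"
  and Const_add: "Const (c + d) = Const c + Const d"
  and Const_mult: "Const (c * d) = Const c * Const d"
  by (simp_all add: Const_def single_add mult_single)

lemma Const_mult_cancel:
  assumes "Const c * f = Const c * g" and "c \<noteq> 0"
  shows "f = g"
proof -
  have "f = Const (inverse c) * (Const c * f)"
    using assms(2) by (simp add: Const_mult [symmetric] mult.assoc [symmetric])
  also have "\<dots> = Const (inverse c) * (Const c * g)"
    using assms(1) by simp
  also have "\<dots> = g"
    using assms(2) by (simp add: Const_mult [symmetric] mult.assoc [symmetric])
  finally show ?thesis .
qed

text \<open>Rational coefficients are wrapped in \<open>Const\<close>; identities are therefore
  proved for integer multiples, and the factor is cancelled here.\<close>

lemma numeral_mult_cancel: "f = g" if "numeral k * f = numeral k * g" for f g :: P2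
  using Const_mult_cancel [of "numeral k" f g] that by simp

lemma poly_mapping_single_induct [case_names zero single_add]:
  fixes f :: "'a \<Rightarrow>\<^sub>0 'b::comm_monoid_add"
  assumes "Pr 0"
    and "\<And>m c f. Pr f \<Longrightarrow> Pr (Poly_Mapping.single m c + f)"
  shows "Pr f"
proof (induction f rule: Poly_Mapping.update_induct)
  case const
  show ?case by (rule assms(1))
next
  case (update f m c)
  have "Poly_Mapping.update m c f = Poly_Mapping.single m c + f"
    using update(1)
    by (intro poly_mapping_eqI)
      (auto simp: lookup_update lookup_add lookup_single when_def in_keys_iff)
  then show ?case
    using assms(2) update.IH by simp
qed

lemma Var_power: "Var v ^ k = Poly_Mapping.single (Poly_Mapping.single v k) 1"
  by (induction k) (simp_all add: Var_def mult_single single_add [symmetric])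

text \<open>Every monomial is a product of variable powers, so properties stable under sums and
  products need checking only on constants and variables.\<close>

lemma P2_induct [case_names Const Var add mult]:
  assumes Const: "\<And>c. Pr (Const c)" and Var: "\<And>v. Pr (Var v)"
    and add: "\<And>f g. Pr f \<Longrightarrow> Pr g \<Longrightarrow> Pr (f + g)"
    and mult: "\<And>f g. Pr f \<Longrightarrow> Pr g \<Longrightarrow> Pr (f * g)"
  shows "Pr f"
proof -
  have Var_power_Pr: "Pr (Var v ^ k)" for v k
    using Const [of 1] by (induction k) (simp_all add: Var mult)
  have "Pr (Poly_Mapping.single m 1)" for m
  proof (induction m rule: poly_mapping_single_induct)
    case zero
    show ?case using Const [of 1] by (simp add: Const_def)
  next
    case (single_add v k m)
    have "Poly_Mapping.single (Poly_Mapping.single v k + m) (1::complex)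
        = Var v ^ k * Poly_Mapping.single m 1"
      by (simp add: Var_power mult_single)
    then show ?case using mult Var_power_Pr single_add by simp
  qed
  then have monomial: "Pr (Poly_Mapping.single m c)" for m c
    using mult [OF Const [of c], of "Poly_Mapping.single m 1"] by (simp add: Const_def mult_single)
  show ?thesis
    using Const [of 0] add monomial by (induction f rule: poly_mapping_single_induct) auto
qed

text \<open>Serves twice: \<open>h\<close> the identity gives evaluation at a point,
  \<open>h = Const\<close> gives endomorphisms of the polynomial ring.\<close>

locale coeff_hom =
  fixes h :: "complex \<Rightarrow> 'b::comm_ring_1"
  assumes hom_one: "h 1 = 1"
    and hom_add: "h (c + d) = h c + h d"
    and hom_mult: "h (c * d) = h c * h d"
begin

lemma hom_zero: "h 0 = 0"
  using hom_add [of 0 0] by simp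

lemma substitute_zero [simp]: "substitute h F 0 = 0"
  by (simp add: substitute_def)

lemma substitute_add [simp]: "substitute h F (f + g) = substitute h F f + substitute h F g"
  unfolding substitute_def
  by (rule setsum_keys_plus_distrib) (simp_all add: hom_zero hom_add distrib_right)

lemma substitute_single:
  "substitute h F (Poly_Mapping.single m c)
    = h c * (\<Prod>v\<in>UNIV. (F $ v) ^ Poly_Mapping.lookup m v)"
  by (cases "c = 0") (simp_all add: substitute_def hom_zero)

lemma substitute_mult_single:
  "substitute h F (Poly_Mapping.single m c * g)
    = substitute h F (Poly_Mapping.single m c) * substitute h F g"
  by (induction g rule: poly_mapping_single_induct)
    (simp_all add: distrib_left mult_single substitute_single hom_mult lookup_add power_add
      prod.distrib mult_ac)

lemma substitute_mult [simp]: "substitute h F (f * g) = substitute h F f * substitute h F g"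
  by (induction f rule: poly_mapping_single_induct)
    (simp_all add: distrib_right substitute_mult_single)

lemma substitute_Const [simp]: "substitute h F (Const c) = h c"
  by (simp add: Const_def substitute_single)

lemma substitute_Var [simp]: "substitute h F (Var v) = F $ v"
proof -
  have "(\<Prod>w\<in>UNIV. (F $ w) ^ Poly_Mapping.lookup (Poly_Mapping.single v 1) w)
      = (\<Prod>w\<in>UNIV. if w = v then F $ w else 1)"
    by (intro prod.cong) (auto simp: lookup_single when_def)
  then show ?thesis
    by (simp add: Var_def substitute_single hom_one)
qed

lemma substitute_one [simp]: "substitute h F 1 = 1"
  using substitute_Const [of F 1] by (simp add: hom_one)

lemma substitute_numeral [simp]: "substitute h F (numeral k) = numeral k"
proof -
  have "substitute h F (of_nat n) = of_nat n" for n
    by (induction n) simp_all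
  from this [of "numeral k"] show ?thesis by simp
qed

lemma substitute_power [simp]: "substitute h F (f ^ k) = substitute h F f ^ k"
  by (induction k) simp_all

lemma substitute_uminus [simp]: "substitute h F (- f) = - substitute h F f"
  using substitute_add [of F f "- f"] by (simp add: eq_neg_iff_add_eq_0 add.commute)

lemma substitute_diff [simp]: "substitute h F (f - g) = substitute h F f - substitute h F g"
  using substitute_add [of F f "- g"] by simp

end

interpretation Const: coeff_hom Const
  by unfold_locales (simp_all add: Const_add Const_mult)

interpretation eval: coeff_hom "\<lambda>c. c"
  by unfold_locales simp_all

lemma algebra_endo_subst_hom: "algebra_endo (subst_hom F)"
  by (simp add: algebra_endo_def)

text \<open>Both sides are homomorphisms in \<open>f\<close> that agree on constants and variables:
  \<open>subst_hom F\<close> is pullback along \<open>point_map F\<close>.\<close>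

lemma eval_at_subst_hom: "eval_at a (subst_hom F f) = eval_at (point_map F a) f"
  by (induction f rule: P2_induct) (simp_all add: point_map_def)

text \<open>Surjectivity makes each coordinate function a pullback, so the coordinates of a point
  are determined by its image.\<close>

lemma inj_point_map_if_surj_subst_hom:
  assumes "surj (subst_hom F)"
  shows "inj (point_map F)"
proof (rule injI)
  fix a b
  assume ab: "point_map F a = point_map F b"
  have "a $ v = b $ v" for v
  proof -
    obtain g where "Var v = subst_hom F g"
      using assms by (meson surjD)
    then have "a $ v = eval_at a (subst_hom F g)" "b $ v = eval_at b (subst_hom F g)"
      by (metis eval.substitute_Var)+
    then show ?thesis
      using ab by (simp add: eval_at_subst_hom)
  qed
  then show "a = b"
    by (simp add: vec_eq_iff)
qed


section \<open>Derivations and the Poisson bracket\<close>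

locale derivation =
  fixes d :: "P2 \<Rightarrow> P2"
  assumes d_add [simp]: "d (f + g) = d f + d g"
    and d_mult: "d (f * g) = f * d g + g * d f"
    and d_Const [simp]: "d (Const c) = 0"
begin

lemma d_zero [simp]: "d 0 = 0" and d_one [simp]: "d 1 = 0" and d_numeral [simp]: "d (numeral k) = 0"
  using d_Const [of 0] d_Const [of 1] d_Const [of "numeral k"] by simp_all

lemma d_uminus [simp]: "d (- f) = - d f"
  using d_add [of f "- f"] by (simp add: eq_neg_iff_add_eq_0 add.commute)

lemma d_diff [simp]: "d (f - g) = d f - d g"
  using d_add [of f "- g"] by simp

lemma d_power: "d (f ^ Suc k) = of_nat (Suc k) * f ^ k * d f"
  by (induction k) (simp_all add: d_mult algebra_simps)

lemma d_power_numeral: "d (f ^ numeral k) = numeral k * f ^ pred_numeral k * d f"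
  using d_power [of f "pred_numeral k"] by (simp only: numeral_eq_Suc [symmetric] of_nat_numeral)

lemmas d_simps = d_mult d_power_numeral

end

section \<open>Partial derivatives as derivations\<close>

lemma partial_zero [simp]: "partial v 0 = 0"
  by (simp add: partial_def)

lemma partial_add: "partial v (f + g) = partial v f + partial v g"
  unfolding partial_def
  by (rule setsum_keys_plus_distrib) (simp_all add: distrib_left single_add)

lemma partial_single:
  "partial v (Poly_Mapping.single m c)
    = Poly_Mapping.single (m - Poly_Mapping.single v 1) (of_nat (Poly_Mapping.lookup m v) * c)"
  by (cases "c = 0") (simp_all add: partial_def)

lemma partial_mult_single_single:
  "partial v (Poly_Mapping.single m c * Poly_Mapping.single n d)
    = Poly_Mapping.single m c * partial v (Poly_Mapping.single n d)
      + Poly_Mapping.single n d * partial v (Poly_Mapping.single m c)"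
proof -
  let ?e = "Poly_Mapping.single v (1::nat)"
  \<comment> \<open>Exponent subtraction truncates at 0, so it commutes with adding \<open>m\<close>
    only if \<open>v\<close> occurs in \<open>n\<close>; otherwise the coefficient in
    \<open>term_eq\<close> vanishes.\<close>
  have shift: "m + n - ?e = m + (n - ?e)" if "Poly_Mapping.lookup n v \<noteq> 0"
      for m n :: "coord \<Rightarrow>\<^sub>0 nat"
    using that
    by (intro poly_mapping_eqI) (auto simp: lookup_add lookup_minus lookup_single when_def)
  have term_eq: "Poly_Mapping.single (m + n - ?e) (c * d * of_nat (Poly_Mapping.lookup n v))
      = Poly_Mapping.single m c
        * Poly_Mapping.single (n - ?e) (of_nat (Poly_Mapping.lookup n v) * d)"
    for m n c and d :: complex
    by (cases "Poly_Mapping.lookup n v = 0") (simp_all add: mult_single shift mult_ac del: One_nat_def)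
  show ?thesis
    using term_eq [of m n c d] term_eq [of n m d c]
    by (simp add: partial_single mult_single lookup_add distrib_left single_add add.commute
        mult.commute del: One_nat_def)
qed

lemma partial_mult_single:
  "partial v (Poly_Mapping.single m c * g)
    = Poly_Mapping.single m c * partial v g + g * partial v (Poly_Mapping.single m c)"
  by (induction g rule: poly_mapping_single_induct)
    (simp_all add: partial_add partial_mult_single_single algebra_simps)

lemma partial_mult: "partial v (f * g) = f * partial v g + g * partial v f"
  by (induction f rule: poly_mapping_single_induct)
    (simp_all add: partial_add partial_mult_single distrib_left distrib_right add_ac)

interpretation partial: derivation "partial v"
  by unfold_locales (simp_all add: partial_add partial_mult Const_def partial_single)

lemma partial_Var: "partial v (Var w) = (if v = w then 1 else 0)"
  by (simp add: Var_def partial_single lookup_single when_def)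

section \<open>The bracket as a biderivation\<close>

lemma pbracket_antisym: "pbracket f g = - pbracket g f"
  by (simp add: pbracket_def algebra_simps)

lemma pbracket_self [simp]: "pbracket f f = 0"
  by (simp add: pbracket_def algebra_simps)

interpretation bracket_right: derivation "pbracket f"
  by unfold_locales (simp_all add: pbracket_def partial_mult algebra_simps)

interpretation bracket_left: derivation "\<lambda>f. pbracket f g"
  by unfold_locales (simp_all add: pbracket_def partial_mult algebra_simps)

text \<open>The bracket is a derivation in each argument, so the relations on variables extend to
  all polynomials, first in the right argument, then in the left.\<close>

lemma poisson_endo_subst_hom:
  assumes gens: "\<And>v w. pbracket (F $ v) (F $ w) = pbracket (Var v) (Var w)"
  shows "poisson_endo (subst_hom F)"
proof -
  let ?\<Phi> = "subst_hom F"
  have Var_Var: "?\<Phi> (pbracket (Var v) (Var w)) = pbracket (?\<Phi> (Var v)) (?\<Phi> (Var w))" for v w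
  proof -
    \<comment> \<open>Brackets of variables are the constants 0, 1 or -1, which the homomorphism
      fixes.\<close>
    have "?\<Phi> (pbracket (Var v) (Var w)) = pbracket (Var v) (Var w)"
      by (simp add: pbracket_def partial_Var)
    then show ?thesis by (simp add: gens)
  qed
  have Var_left: "?\<Phi> (pbracket (Var v) g) = pbracket (?\<Phi> (Var v)) (?\<Phi> g)" for v g
    by (induction g rule: P2_induct) (use Var_Var in \<open>simp_all add: bracket_right.d_mult\<close>)
  have "?\<Phi> (pbracket f g) = pbracket (?\<Phi> f) (?\<Phi> g)" for f g
    by (induction f rule: P2_induct) (use Var_left in \<open>simp_all add: bracket_left.d_mult\<close>)
  then show ?thesis
    by (simp add: poisson_endo_def algebra_endo_subst_hom)
qed

text \<open>Leibniz expansion over the 24 permutations, enumerated by inserting one coordinate at a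
  time.\<close>

lemma det_coord:
  fixes A :: "'a::comm_ring_1 ^ coord ^ coord"
  shows "det A =
      A$X$X * A$Q$Q * A$P$P * A$Z$Z - A$X$X * A$Q$Q * A$P$Z * A$Z$P
    - A$X$X * A$Q$P * A$P$Q * A$Z$Z + A$X$X * A$Q$P * A$P$Z * A$Z$Q
    + A$X$X * A$Q$Z * A$P$Q * A$Z$P - A$X$X * A$Q$Z * A$P$P * A$Z$Q
    - A$X$Q * A$Q$X * A$P$P * A$Z$Z + A$X$Q * A$Q$X * A$P$Z * A$Z$P
    + A$X$Q * A$Q$P * A$P$X * A$Z$Z - A$X$Q * A$Q$P * A$P$Z * A$Z$X
    - A$X$Q * A$Q$Z * A$P$X * A$Z$P + A$X$Q * A$Q$Z * A$P$P * A$Z$X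
    + A$X$P * A$Q$X * A$P$Q * A$Z$Z - A$X$P * A$Q$X * A$P$Z * A$Z$Q
    - A$X$P * A$Q$Q * A$P$X * A$Z$Z + A$X$P * A$Q$Q * A$P$Z * A$Z$X
    + A$X$P * A$Q$Z * A$P$X * A$Z$Q - A$X$P * A$Q$Z * A$P$Q * A$Z$X
    - A$X$Z * A$Q$X * A$P$Q * A$Z$P + A$X$Z * A$Q$X * A$P$P * A$Z$Q
    + A$X$Z * A$Q$Q * A$P$X * A$Z$P - A$X$Z * A$Q$Q * A$P$P * A$Z$X
    - A$X$Z * A$Q$P * A$P$X * A$Z$Q + A$X$Z * A$Q$P * A$P$Q * A$Z$X"
proof -
  have UNIV: "(UNIV :: coord set) = {X, Q, P, Z}"
    using coord.exhaust by blast
  have "finite {Q, P, Z}" "X \<notin> {Q, P, Z}" "finite {P, Z}" "Q \<notin> {P, Z}" "finite {Z}" "P \<notin> {Z}"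
    by auto
  note inserts = sum_over_permutations_insert [OF this(1,2)]
    sum_over_permutations_insert [OF this(3,4)] sum_over_permutations_insert [OF this(5,6)]
  show ?thesis
    unfolding det_def UNIV inserts permutes_sing
    by (simp add: sign_swap_id permutation_swap_id permutation_compose sign_compose sign_id
        transpose_def algebra_simps)
qed

text \<open>The Pfaffian of \<open>J \<Omega> J\<^sup>T\<close> is \<open>det J\<close> times the Pfaffian of the standard symplectic form \<open>\<Omega>\<close>.\<close>

lemma det_jacobian_pfaffian:
  "det (jacobian_matrix F) =
     pbracket (F $ P) (F $ X) * pbracket (F $ Z) (F $ Q)
     - pbracket (F $ P) (F $ Z) * pbracket (F $ X) (F $ Q)
     + pbracket (F $ P) (F $ Q) * pbracket (F $ X) (F $ Z)"
  by (simp add: det_coord jacobian_matrix_def pbracket_def algebra_simps)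


section \<open>Brackets of polynomials in \<open>x\<close>, \<open>y\<close>, \<open>\<beta>\<close>\<close>

lemmas poly_arith = eval_nat_numeral algebra_simps

text \<open>The element \<open>d0\<close> stands for \<open>60 D\<^sub>0\<close> and \<open>w\<close> for \<open>3 q\<close>. Denominators are cleared throughout:
  \<open>t2\<close> and \<open>h60\<close> are \<open>2 T\<close> and \<open>60 H\<close>, so that all identities hold over \<open>\<int>\<close>.\<close>

locale bracket_frame =
  fixes x y b w d0 :: P2
  assumes bracket_yx: "pbracket y x = - (x ^ 3)"
    and bracket_bx: "pbracket b x = 3 * x ^ 2"
    and bracket_by: "pbracket b y = 2 - 6 * x * y - 3 * x ^ 2 * b"
    and w_eq: "w = 3 * y + x * b"
    and bracket_d0x: "pbracket d0 x = 30 * (1 + w * x)"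
    and bracket_d0y: "pbracket d0 y = - 10 * (2 * w ^ 2 + (1 + x * w) * b + x * (3 * w * b + 7 * w ^ 3))"
    and bracket_d0b: "pbracket d0 b = 30 * (3 * w * b + 7 * w ^ 3)"
begin

text \<open>\<open>x\<close>, \<open>y\<close>, \<open>b\<close> are ring elements, not variables,
  so partial derivatives in them are encoded by the chain rule for all derivations, including the
  bracket in either slot.\<close>

definition grad :: "P2 \<Rightarrow> P2 \<Rightarrow> P2 \<Rightarrow> P2 \<Rightarrow> bool" where
  "grad f fx fy fb \<longleftrightarrow> (\<forall>d. derivation d \<longrightarrow> d f = fx * d x + fy * d y + fb * d b)"

lemma gradI:
  assumes "\<And>d dx dy db. derivation d \<Longrightarrow> d x = dx \<Longrightarrow> d y = dy \<Longrightarrow> d b = db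
    \<Longrightarrow> d f - (fx * dx + fy * dy + fb * db) = 0"
  shows "grad f fx fy fb"
  using assms by (auto simp: grad_def)

text \<open>The chain rule in both slots. With the partials of \<open>r\<close> from
  \<open>grad_r\<close>, the right-hand side is minus the Jacobian determinant of
  \<open>(r, f, g)\<close> in \<open>(x, y, b)\<close>.\<close>

lemma pbracket_grad:
  assumes f: "grad f fx fy fb" and g: "grad g gx gy gb"
  shows "pbracket f g = (fx * gy - fy * gx) * x ^ 3 + 3 * (fb * gx - fx * gb) * x ^ 2
    + (fb * gy - fy * gb) * (2 - 6 * x * y - 3 * x ^ 2 * b)"
proof -
  have left: "pbracket f g = fx * pbracket x g + fy * pbracket y g + fb * pbracket b g"
    by (rule f [unfolded grad_def, rule_format, OF bracket_left.derivation_axioms])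
  have right: "pbracket v g = gx * pbracket v x + gy * pbracket v y + gb * pbracket v b" for v
    by (rule g [unfolded grad_def, rule_format, OF bracket_right.derivation_axioms])
  have "pbracket f g - ((fx * gy - fy * gx) * x ^ 3 + 3 * (fb * gx - fx * gb) * x ^ 2
      + (fb * gy - fy * gb) * (2 - 6 * x * y - 3 * x ^ 2 * b)) = 0"
    unfolding left right [of x] right [of y] right [of b] pbracket_self bracket_yx bracket_bx
      bracket_by pbracket_antisym [of x y] pbracket_antisym [of x b] pbracket_antisym [of y b]
    by (simp add: poly_arith)
  then show ?thesis by simp
qed

lemma pbracket_d0_grad:
  assumes "grad g gx gy gb"
  shows "pbracket d0 g = gx * (30 * (1 + w * x))
    + gy * (- 10 * (2 * w ^ 2 + (1 + x * w) * b + x * (3 * w * b + 7 * w ^ 3)))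
    + gb * (30 * (3 * w * b + 7 * w ^ 3))"
  unfolding bracket_d0x [symmetric] bracket_d0y [symmetric] bracket_d0b [symmetric]
  by (rule assms [unfolded grad_def, rule_format, OF bracket_right.derivation_axioms])

abbreviation "r \<equiv> 2 * x - 3 * x ^ 2 * y - x ^ 3 * b"

abbreviation "s \<equiv> y + 3 * x * (1 + x * y) ^ 2 * b + 3 * x * y ^ 2 * (4 + 3 * (x * y))"

abbreviation "t2 \<equiv> - ((1 + x * y) ^ 3 * b + y ^ 2 * (1 + x * y) * (4 + 3 * (x * y)))"

abbreviation "h60 \<equiv> 3 * y ^ 4 * (18 * (x * y) ^ 2 + 78 * (x * y) + 125)
  + 18 * b * y ^ 2 * ((x * y) ^ 3 + 5 * (x * y) ^ 2 + 10 * (x * y) - 5)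
  - 10 * b ^ 2 * (9 * (x * y) + 2) - 10 * x ^ 2 * b ^ 3"

lemma grad_r:
  "grad r
    (2 - 6 * x * y - 3 * x ^ 2 * b)
    (- 3 * x ^ 2)
    (- (x ^ 3))"
proof (rule gradI, goal_cases)
  case (1 d dx dy db)
  interpret derivation d by fact
  show ?case by (simp add: 1(2-4) d_simps poly_arith)
qed

lemma grad_s:
  "grad s
    (3 * b + 12 * y ^ 2 + 12 * x * y * b + 18 * x * y ^ 3 + 9 * x ^ 2 * y ^ 2 * b)
    (1 + 24 * x * y + 6 * x ^ 2 * b + 27 * x ^ 2 * y ^ 2 + 6 * x ^ 3 * y * b)
    (3 * x + 6 * x ^ 2 * y + 3 * x ^ 3 * y ^ 2)"
proof (rule gradI, goal_cases)
  case (1 d dx dy db)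
  interpret derivation d by fact
  show ?case by (simp add: 1(2-4) d_simps poly_arith)
qed

lemma grad_t2:
  "grad t2
    (- 3 * y * b - 7 * y ^ 3 - 6 * x * y ^ 2 * b - 6 * x * y ^ 4 - 3 * x ^ 2 * y ^ 3 * b)
    (- 8 * y - 3 * x * b - 21 * x * y ^ 2 - 6 * x ^ 2 * y * b - 12 * x ^ 2 * y ^ 3 - 3 * x
      ^ 3 * y ^ 2 * b)
    (- 1 - 3 * x * y - 3 * x ^ 2 * y ^ 2 - x ^ 3 * y ^ 3)"
proof (rule gradI, goal_cases)
  case (1 d dx dy db)
  interpret derivation d by fact
  show ?case by (simp add: 1(2-4) d_simps poly_arith)
qed

lemma grad_h60:
  "grad h60
    (- 90 * y * b ^ 2 + 180 * y ^ 3 * b + 234 * y ^ 5 - 20 * x * b ^ 3 + 180 * x * y ^ 4 *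
      b + 108 * x * y ^ 6 + 54 * x ^ 2 * y ^ 5 * b)
    (- 180 * y * b + 1500 * y ^ 3 - 90 * x * b ^ 2 + 540 * x * y ^ 2 * b + 1170 * x * y ^
      4 + 360 * x ^ 2 * y ^ 3 * b + 324 * x ^ 2 * y ^ 5 + 90 * x ^ 3 * y ^ 4 * b)
    (- 40 * b - 90 * y ^ 2 - 180 * x * y * b + 180 * x * y ^ 3 - 30 * x ^ 2 * b ^ 2 + 90 *
      x ^ 2 * y ^ 4 + 18 * x ^ 3 * y ^ 5)"
proof (rule gradI, goal_cases)
  case (1 d dx dy db)
  interpret derivation d by fact
  show ?case by (simp add: 1(2-4) d_simps poly_arith)
qed

text \<open>\<open>r\<close> is a Casimir for polynomials in \<open>x\<close>, \<open>y\<close>,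
  \<open>b\<close>: the Jacobian determinant giving the bracket has a repeated row. The same
  accounts for \<open>bracket_s_r\<close>.\<close>

lemma bracket_r_t2: "pbracket r t2 = 0"
  by (subst pbracket_grad [OF grad_r grad_t2]) (simp add: poly_arith)

lemma bracket_s_r: "pbracket s r = 0"
  by (subst pbracket_grad [OF grad_s grad_r]) (simp add: poly_arith)

text \<open>Equivalently, the Jacobian determinant of \<open>(r, s, t2)\<close> in
  \<open>(x, y, b)\<close> is the constant -2.\<close>

lemma bracket_s_t2: "pbracket s t2 = 2"
  by (subst pbracket_grad [OF grad_s grad_t2]) (simp add: poly_arith)

text \<open>As \<open>r\<close> is a Casimir, \<open>h60\<close> contributes nothing and the value
  comes from \<open>d0\<close> alone.\<close>

lemma bracket_d_r: "pbracket (d0 + h60) r = 60"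
  by (subst bracket_left.d_add, subst pbracket_d0_grad [OF grad_r],
      subst pbracket_grad [OF grad_h60 grad_r]) (simp add: w_eq poly_arith)

text \<open>Here the correction matters: the bracket of \<open>h60\<close> with \<open>s\<close>
  cancels that of \<open>d0\<close>, and likewise for \<open>t2\<close> below.\<close>

lemma bracket_d_s: "pbracket (d0 + h60) s = 0"
  by (subst bracket_left.d_add, subst pbracket_d0_grad [OF grad_s],
      subst pbracket_grad [OF grad_h60 grad_s]) (simp add: w_eq poly_arith)

lemma bracket_d_t2: "pbracket (d0 + h60) t2 = 0"
  by (subst bracket_left.d_add, subst pbracket_d0_grad [OF grad_t2],
      subst pbracket_grad [OF grad_h60 grad_t2]) (simp add: w_eq poly_arith)

end

section \<open>The map \<open>\<Phi>\<close>\<close>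

lemma three_y: "3 * y_poly = 3 * qv - xv * beta_poly"
proof -
  have "3 * Const (1/3) = 1"
    by (simp flip: Const_numeral Const_mult)
  then have "3 * (Const (1/3) * f) = f" for f
    by (simp flip: mult.assoc)
  then show ?thesis
    by (simp add: y_poly_def right_diff_distrib mult.assoc)
qed

lemma two_T: "2 * T_poly = - ((1 + u_poly)^3 * beta_poly + y_poly^2 * (1 + u_poly) * (4 + 3 * u_poly))"
proof -
  have "2 * Const (1/2) = 1"
    by (simp flip: Const_numeral Const_mult)
  then have "2 * (Const (1/2) * f) = f" for f
    by (simp flip: mult.assoc)
  then show ?thesis
    by (simp add: T_poly_def)
qed

lemma sixty_D0: "60 * D0_poly = 30 * (1 + 3 * xv * qv) * pv - 180 * qv ^ 2 * zv"
proof -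
  have "60 * Const (1/2) = 30"
    by (simp flip: Const_numeral Const_mult)
  then have "60 * (Const (1/2) * f) = 30 * f" for f
    by (simp flip: mult.assoc)
  then show ?thesis
    by (simp only: D0_poly_def right_diff_distrib mult.assoc) simp
qed

lemma sixty_H: "60 * H_poly = 3 * y_poly ^ 4 * (18 * u_poly ^ 2 + 78 * u_poly + 125)
  + 18 * beta_poly * y_poly ^ 2 * (u_poly ^ 3 + 5 * u_poly ^ 2 + 10 * u_poly - 5)
  - 10 * beta_poly ^ 2 * (9 * u_poly + 2) - 10 * xv ^ 2 * beta_poly ^ 3"
proof -
  have "60 * Const (1/20) = 3" "60 * Const (3/10) = 18" "60 * Const (1/6) = 10"
    by (simp_all flip: Const_numeral Const_mult)
  then have "60 * (Const (1/20) * f) = 3 * f" "60 * (Const (3/10) * f) = 18 * f"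
      "60 * (Const (1/6) * f) = 10 * f" for f
    by (simp_all flip: mult.assoc)
  then show ?thesis
    by (simp add: H_poly_def distrib_left right_diff_distrib mult.assoc)
qed

section \<open>Brackets of the concrete \<open>x\<close>, \<open>y\<close>, \<beta> and of
  \<open>60 * D0_poly\<close>\<close>

lemma pbracket_Var_Var:
  "pbracket xv qv = 0" "pbracket qv xv = 0" "pbracket xv pv = - 1" "pbracket pv xv = 1"
  "pbracket xv zv = 0" "pbracket zv xv = 0" "pbracket qv pv = 0" "pbracket pv qv = 0"
  "pbracket qv zv = - 1" "pbracket zv qv = 1" "pbracket pv zv = 0" "pbracket zv pv = 0"
  by (simp_all add: pbracket_def partial_Var)

lemma beta_eq: "beta_poly = 3 * xv ^ 2 * pv + 2 * (1 - 3 * xv * qv) * zv - 9 * qv ^ 2"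
  by (simp add: beta_poly_def B_poly_def a_poly_def)

lemmas bracket_simps =
  bracket_left.d_simps bracket_right.d_simps pbracket_Var_Var

lemma bracket_beta_x: "pbracket beta_poly xv = 3 * xv ^ 2"
  by (simp add: beta_eq bracket_simps)

lemma bracket_beta_q: "pbracket beta_poly qv = 2 - 6 * xv * qv"
  by (simp add: beta_eq bracket_simps algebra_simps)

text \<open>The Leibniz rule applied to the integral relation \<open>3 y = 3 q - x\<close>
  \<beta>.\<close>

lemma bracket_y: "3 * pbracket f y_poly
    = 3 * pbracket f qv - xv * pbracket f beta_poly - beta_poly * pbracket f xv"
proof -
  have "3 * pbracket f y_poly = pbracket f (3 * y_poly)"
    by (simp add: bracket_right.d_mult)
  then show ?thesis
    by (simp add: three_y bracket_right.d_mult)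
qed

lemma bracket_y_x: "pbracket y_poly xv = - (xv ^ 3)"
proof (rule numeral_mult_cancel)
  have "3 * pbracket xv y_poly = 3 * xv ^ 3"
    by (simp add: bracket_y pbracket_Var_Var pbracket_antisym [of xv beta_poly] bracket_beta_x
        power2_eq_square power3_eq_cube)
  then show "3 * pbracket y_poly xv = 3 * - (xv ^ 3)"
    by (simp add: pbracket_antisym [of y_poly xv])
qed

lemma bracket_beta_y: "pbracket beta_poly y_poly = 2 - 6 * xv * y_poly - 3 * xv ^ 2 * beta_poly"
proof (rule numeral_mult_cancel)
  have "3 * pbracket beta_poly y_poly = 6 - 6 * xv * (3 * qv) - 3 * xv ^ 2 * beta_poly"
    unfolding bracket_y bracket_beta_x bracket_beta_q by (simp add: algebra_simps)
  \<comment> \<open>Eliminating \<open>q\<close> is what closes the bracket on polynomials in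
    \<open>x\<close>, \<open>y\<close>, \<beta>.\<close>
  also have "3 * qv = 3 * y_poly + xv * beta_poly"
    using three_y by simp
  finally show "3 * pbracket beta_poly y_poly
      = 3 * (2 - 6 * xv * y_poly - 3 * xv ^ 2 * beta_poly)"
    by (simp add: algebra_simps power2_eq_square)
qed

lemma bracket_D0_x: "pbracket (60 * D0_poly) xv = 30 * (1 + (3 * qv) * xv)"
  unfolding sixty_D0 by (simp add: bracket_simps algebra_simps)

lemma bracket_D0_q: "pbracket (60 * D0_poly) qv = - 180 * qv ^ 2"
  unfolding sixty_D0 by (simp add: bracket_simps algebra_simps)

lemma bracket_D0_beta:
  "pbracket (60 * D0_poly) beta_poly = 30 * (3 * (3 * qv) * beta_poly + 7 * (3 * qv) ^ 3)"
  unfolding sixty_D0 beta_eq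
  by (simp add: bracket_simps algebra_simps power2_eq_square power3_eq_cube)

lemma bracket_D0_y:
  "pbracket (60 * D0_poly) y_poly = - 10 * (2 * (3 * qv) ^ 2 + (1 + xv * (3 * qv)) * beta_poly
    + xv * (3 * (3 * qv) * beta_poly + 7 * (3 * qv) ^ 3))"
proof (rule numeral_mult_cancel)
  show "3 * pbracket (60 * D0_poly) y_poly
    = 3 * (- 10 * (2 * (3 * qv) ^ 2 + (1 + xv * (3 * qv)) * beta_poly
      + xv * (3 * (3 * qv) * beta_poly + 7 * (3 * qv) ^ 3)))"
    by (simp only: bracket_y bracket_D0_x bracket_D0_q bracket_D0_beta)
      (simp add: algebra_simps power2_eq_square power3_eq_cube)
qed

interpretation frame: bracket_frame xv y_poly beta_poly "3 * qv" "60 * D0_poly"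
proof
  show "3 * qv = 3 * y_poly + xv * beta_poly"
    by (simp add: three_y)
qed (fact bracket_y_x bracket_beta_x bracket_beta_y bracket_D0_x bracket_D0_y bracket_D0_beta)+

lemma R_eq: "R_poly = 2 * xv - 3 * xv ^ 2 * y_poly - xv ^ 3 * beta_poly"
  and S_eq: "S_poly = y_poly + 3 * xv * (1 + xv * y_poly) ^ 2 * beta_poly
    + 3 * xv * y_poly ^ 2 * (4 + 3 * (xv * y_poly))"
  by (simp_all add: R_poly_def S_poly_def u_poly_def)

lemma sixty_D: "60 * D_poly = 60 * D0_poly + 60 * H_poly"
  by (simp add: D_poly_def distrib_left)

lemmas scaled = two_T sixty_D sixty_H u_poly_def R_eq S_eq

section \<open>The canonical relations between \<open>R\<close>, \<open>T\<close>, \<open>D\<close>,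
  \<open>S\<close>\<close>

lemma bracket_R_T: "pbracket R_poly T_poly = 0"
proof (rule numeral_mult_cancel)
  have "pbracket R_poly (2 * T_poly) = 0"
    unfolding scaled by (rule frame.bracket_r_t2)
  then show "2 * pbracket R_poly T_poly = 2 * 0"
    by (simp add: bracket_right.d_mult)
qed

lemma bracket_S_R: "pbracket S_poly R_poly = 0"
  unfolding scaled by (rule frame.bracket_s_r)

lemma bracket_S_T: "pbracket S_poly T_poly = 1"
proof (rule numeral_mult_cancel)
  have "pbracket S_poly (2 * T_poly) = 2"
    unfolding scaled by (rule frame.bracket_s_t2)
  then show "2 * pbracket S_poly T_poly = 2 * 1"
    by (simp add: bracket_right.d_mult)
qed

lemma bracket_D_R: "pbracket D_poly R_poly = 1"
proof (rule numeral_mult_cancel)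
  have "pbracket (60 * D_poly) R_poly = 60"
    unfolding scaled by (rule frame.bracket_d_r)
  then show "60 * pbracket D_poly R_poly = 60 * 1"
    by (simp add: bracket_left.d_mult)
qed

lemma bracket_D_S: "pbracket D_poly S_poly = 0"
proof (rule numeral_mult_cancel)
  have "pbracket (60 * D_poly) S_poly = 0"
    unfolding scaled by (rule frame.bracket_d_s)
  then show "60 * pbracket D_poly S_poly = 60 * 0"
    by (simp add: bracket_left.d_mult)
qed

lemma bracket_D_T: "pbracket D_poly T_poly = 0"
proof (rule numeral_mult_cancel)
  have "pbracket (60 * D_poly) (2 * T_poly) = 0"
    unfolding scaled by (rule frame.bracket_d_t2)
  moreover have "pbracket (60 * D_poly) (2 * T_poly) = 60 * (2 * pbracket D_poly T_poly)"
    unfolding bracket_left.d_mult [of 60] bracket_right.d_mult [of _ 2] by simp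
  ultimately show "120 * pbracket D_poly T_poly = 120 * 0"
    by simp
qed

lemma tuple_nth [simp]:
  "tuple a b c d $ X = a" "tuple a b c d $ Q = b" "tuple a b c d $ P = c" "tuple a b c d $ Z = d"
  by (simp_all add: tuple_def)

lemma all_coord: "(\<forall>v. Pr v) \<longleftrightarrow> Pr X \<and> Pr Q \<and> Pr P \<and> Pr Z"
  by (metis coord.exhaust)

lemma vec_coord_eq_iff:
  fixes v w :: "'a ^ coord"
  shows "v = w \<longleftrightarrow> v $ X = w $ X \<and> v $ Q = w $ Q \<and> v $ P = w $ P \<and> v $ Z = w $ Z"
  by (simp add: vec_eq_iff all_coord)

lemmas brackets_RTDS =
  bracket_R_T bracket_S_R bracket_S_T bracket_D_R bracket_D_S bracket_D_T

lemma poisson_endo_Phi: "poisson_endo Phi"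
  unfolding Phi_def
proof (rule poisson_endo_subst_hom)
  fix v w
  show "pbracket (Phi_tuple $ v) (Phi_tuple $ w) = pbracket (Var v) (Var w)"
    by (cases v; cases w)
      (simp_all add: Phi_tuple_def pbracket_Var_Var brackets_RTDS
        pbracket_antisym [of R_poly D_poly] pbracket_antisym [of R_poly S_poly]
        pbracket_antisym [of T_poly R_poly] pbracket_antisym [of T_poly D_poly]
        pbracket_antisym [of T_poly S_poly] pbracket_antisym [of S_poly D_poly])
qed

lemma det_jacobian_Phi_tuple: "det (jacobian_matrix Phi_tuple) = 1"
  by (simp add: det_jacobian_pfaffian Phi_tuple_def brackets_RTDS)

section \<open>The fibre over \<open>(0, 1/8, 0, 0)\<close>\<close>

lemma point_map_Phi_tuple_eq_iff:
  fixes v :: "complex ^ coord"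
  defines "x \<equiv> v $ X" and "q \<equiv> v $ Q" and "p \<equiv> v $ P" and "z \<equiv> v $ Z"
  defines "b \<equiv> 3 * x^2 * p + 2 * (1 - 3 * x * q) * z - 9 * q^2"
  defines "y \<equiv> q - 1/3 * x * b"
  defines "u \<equiv> x * y"
  shows "point_map Phi_tuple v = tuple r t d s \<longleftrightarrow>
    2 * x - 3 * x^2 * y - x^3 * b = r
    \<and> - (1/2) * ((1 + u)^3 * b + y^2 * (1 + u) * (4 + 3 * u)) = t
    \<and> 1/2 * (1 + 3 * x * q) * p - 3 * q^2 * z
      + (1/20 * y^4 * (18 * u^2 + 78 * u + 125)
        + 3/10 * b * y^2 * (u^3 + 5 * u^2 + 10 * u - 5)
        - 1/6 * b^2 * (9 * u + 2) - 1/6 * x^2 * b^3) = d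
    \<and> y + 3 * x * (1 + u)^2 * b + 3 * x * y^2 * (4 + 3 * u) = s"
  unfolding vec_coord_eq_iff
  by (simp only: point_map_def Phi_tuple_def tuple_nth vec_lambda_beta R_poly_def T_poly_def
      D_poly_def S_poly_def D0_poly_def H_poly_def u_poly_def y_poly_def beta_poly_def B_poly_def
      a_poly_def u_def y_def b_def x_def q_def p_def z_def eval.substitute_add
      eval.substitute_diff eval.substitute_mult eval.substitute_uminus eval.substitute_power
      eval.substitute_numeral eval.substitute_one eval.substitute_Const eval.substitute_Var)

text \<open>For \<open>x \<noteq> 0\<close>, the equation \<open>R = 0\<close> gives \<open>x\<^sup>2 \<beta> = 2 - 3 u\<close>; then \<open>x S = 6 + 4 u\<close>, so \<open>S = 0\<close>
  fixes \<open>u\<close>, and \<open>T = 1/8\<close> becomes \<open>x\<^sup>2 = 1\<close>.\<close>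

lemma fibre_nonzero_x:
  fixes x y b :: complex
  assumes "x \<noteq> 0"
    and R: "2 * x - 3 * x^2 * y - x^3 * b = 0"
    and T: "- (1/2) * ((1 + x * y)^3 * b + y^2 * (1 + x * y) * (4 + 3 * (x * y))) = 1/8"
    and S: "y + 3 * x * (1 + x * y)^2 * b + 3 * x * y^2 * (4 + 3 * (x * y)) = 0"
  shows "x^2 = 1" "y = - 3/2 * x" "b = 13/2"
proof -
  define u where "u = x * y"
  have "x * (2 - 3 * u - x^2 * b) = 0"
    using R by (simp add: u_def algebra_simps power2_eq_square power3_eq_cube)
  then have b: "x^2 * b = 2 - 3 * u"
    using \<open>x \<noteq> 0\<close> by simp
  have "0 = x * (y + 3 * x * (1 + x * y)^2 * b + 3 * x * y^2 * (4 + 3 * (x * y)))"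
    using S by simp
  also have "\<dots> = u + 3 * (1 + u)^2 * (x^2 * b) + 3 * u^2 * (4 + 3 * u)"
    by (simp add: u_def algebra_simps power2_eq_square)
  also have "\<dots> = 6 + 4 * u"
    unfolding b by (simp add: algebra_simps power2_eq_square)
  finally have eq: "6 + 4 * u = 0" by simp
  have "u = (6 + 4 * u) / 4 - 3/2" by (simp add: field_simps)
  then have u: "u = - 3/2" unfolding eq by simp
  \<comment> \<open>After multiplication by \<open>x^2\<close>, the variables \<open>y\<close> and
    \<open>b\<close> enter only through \<open>u\<close> and \<open>x^2 * b\<close>, both already
    known.\<close>
  have "x^2 / 8 = x^2 * (- (1/2) * ((1 + x * y)^3 * b + y^2 * (1 + x * y) * (4 + 3 * (x * y))))"
    by (simp only: T) simp
  also have "\<dots> = - ((1 + u)^3 * (x^2 * b) + u^2 * (1 + u) * (4 + 3 * u)) / 2"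
    by (simp add: u_def algebra_simps power2_eq_square)
  also have "\<dots> = 1/8"
    unfolding b by (simp add: u power2_eq_square power3_eq_cube)
  finally show x2: "x^2 = 1" by simp
  show "b = 13/2"
    using b by (simp add: x2 u)
  have "y = x^2 * y" by (simp add: x2)
  also have "\<dots> = x * u" by (simp add: u_def power2_eq_square)
  finally show "y = - 3/2 * x" by (simp add: u)
qed

text \<open>The equations for \<open>R\<close>, \<open>S\<close>, \<open>T\<close> determine
  \<open>x^2\<close>, and then \<open>y\<close>, \<open>b\<close> and \<open>q\<close> in terms of
  \<open>x\<close>; the equation for \<open>D\<close> and the definition of \<open>b\<close> then
  fix \<open>p\<close> and \<open>z\<close>.\<close>

lemma fibre_Phi:
  "{v. point_map Phi_tuple v = tuple 0 (1/8) 0 0}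
    = {tuple 0 0 (1/24) (-1/8),
       tuple 1 (2/3) (247/96) (-89/64),
       tuple (-1) (-2/3) (247/96) (-89/64)}" (is "?fibre = ?points")
proof (intro set_eqI iffI)
  fix v :: "complex ^ coord"
  assume "v \<in> ?points"
  then show "v \<in> ?fibre"
    by (auto simp: point_map_Phi_tuple_eq_iff power2_eq_square power3_eq_cube power4_eq_xxxx)
next
  fix v :: "complex ^ coord"
  assume v: "v \<in> ?fibre"
  define x q p z where coords: "x = v $ X" "q = v $ Q" "p = v $ P" "z = v $ Z"
  define b where "b = 3 * x^2 * p + 2 * (1 - 3 * x * q) * z - 9 * q^2"
  define y where "y = q - 1/3 * x * b"
  have R: "2 * x - 3 * x^2 * y - x^3 * b = 0"
    and T: "- (1/2) * ((1 + x * y)^3 * b + y^2 * (1 + x * y) * (4 + 3 * (x * y))) = 1/8"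
    and D: "1/2 * (1 + 3 * x * q) * p - 3 * q^2 * z
      + (1/20 * y^4 * (18 * (x * y)^2 + 78 * (x * y) + 125)
        + 3/10 * b * y^2 * ((x * y)^3 + 5 * (x * y)^2 + 10 * (x * y) - 5)
        - 1/6 * b^2 * (9 * (x * y) + 2) - 1/6 * x^2 * b^3) = 0"
    and S: "y + 3 * x * (1 + x * y)^2 * b + 3 * x * y^2 * (4 + 3 * (x * y)) = 0"
    using v unfolding mem_Collect_eq point_map_Phi_tuple_eq_iff b_def y_def coords by blast+
  have "x = 0 \<and> q = 0 \<and> p = 1/24 \<and> z = - 1/8
    \<or> x = 1 \<and> q = 2/3 \<and> p = 247/96 \<and> z = - 89/64
    \<or> x = - 1 \<and> q = - 2/3 \<and> p = 247/96 \<and> z = - 89/64"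
  proof (cases "x = 0")
    case True
    \<comment> \<open>At \<open>x = 0\<close> the polynomial \<open>S\<close> reduces to
      \<open>y\<close>, and \<open>y\<close> to \<open>q\<close>; \<open>T\<close> then reduces to
      \<open>- b/2 = - z\<close>.\<close>
    then have y: "y = 0" and q: "q = 0" and bz: "b = 2 * z"
      using S by (simp_all add: y_def b_def)
    have "- z = 1/8"
      using T True y bz by simp
    then have z: "z = - 1/8"
      by (metis minus_divide_left minus_minus)
    have p: "p = 1/24"
      using D by (simp add: True y q bz z power2_eq_square field_simps)
    show ?thesis
      by (simp add: True q z p)
  next
    case False
    note xyb = fibre_nonzero_x [OF False R T S]
    have x: "x = 1 \<or> x = - 1"
      using xyb(1) by (simp add: power2_eq_1_iff)
    have "q = y + 1/3 * x * b"
      by (simp add: y_def)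
    also have "\<dots> = 2/3 * x"
      by (simp add: xyb(2,3) field_simps)
    finally have q: "q = 2/3 * x" .
    have monomials: "x * y = - 3/2" "y^2 = 9/4" "y^4 = 81/16" "3 * x * q = 2" "q^2 = 4/9"
      using x by (auto simp: xyb(2) q power2_eq_square power4_eq_xxxx)
    have D': "3/2 * p - 4/3 * z - 1097/192 = 0"
      using D unfolding monomials xyb(1,3)
      by (simp add: power2_eq_square power3_eq_cube algebra_simps)
    have b': "3 * p - 2 * z - 21/2 = 0"
      using b_def unfolding monomials xyb(1,3) by (simp add: algebra_simps)
    \<comment> \<open>\<open>D'\<close> and \<open>b'\<close> form a linear system in
      \<open>p\<close> and \<open>z\<close> of determinant 1; the multipliers here and for
      \<open>z\<close> are the entries of the inverse matrix.\<close>
    have "p - 247/96 = 4/3 * (3 * p - 2 * z - 21/2) - 2 * (3/2 * p - 4/3 * z - 1097/192)"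
      by (simp add: algebra_simps)
    then have p: "p = 247/96"
      unfolding D' b' by simp
    have "z - (- 89/64) = 3/2 * (3 * p - 2 * z - 21/2) - 3 * (3/2 * p - 4/3 * z - 1097/192)"
      by (simp add: algebra_simps)
    then have z: "z = - 89/64"
      unfolding D' b' by (simp only: right_minus_eq mult_zero_right diff_0_right)
    show ?thesis
      using x by (elim disjE) (simp_all add: q p z)
  qed
  then show "v \<in> ?points"
    unfolding insert_iff vec_coord_eq_iff tuple_nth coords [symmetric] by blast
qed

section \<open>Failure of invertibility and of the Poisson Conjecture\<close>

lemma not_algebra_auto_Phi: "\<not> algebra_auto Phi"
proof
  assume "algebra_auto Phi"
  then have "inj (point_map Phi_tuple)"
    unfolding algebra_auto_def Phi_def by (intro inj_point_map_if_surj_subst_hom bij_is_surj) simp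
  moreover have "point_map Phi_tuple (tuple 1 (2/3) (247/96) (-89/64)) = tuple 0 (1/8) 0 0"
    "point_map Phi_tuple (tuple (-1) (-2/3) (247/96) (-89/64)) = tuple 0 (1/8) 0 0"
    using fibre_Phi by blast+
  ultimately have "tuple 1 (2/3) (247/96) (-89/64)
      = (tuple (-1) (-2/3) (247/96) (-89/64) :: complex ^ coord)"
    by (metis injD)
  then show False
    by (simp add: vec_coord_eq_iff)
qed

theorem theorem1p1:
  shows "poisson_endo Phi
    \<and> Phi (Var X) = R_poly \<and> Phi (Var Q) = T_poly \<and> Phi (Var P) = D_poly \<and> Phi (Var Z) = S_poly
    \<and> \<not> algebra_auto Phi
    \<and> det (jacobian_matrix Phi_tuple) = 1
    \<and> {v. point_map Phi_tuple v = tuple 0 (1/8) 0 0}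
        = {tuple 0 0 (1/24) (-1/8),
           tuple 1 (2/3) (247/96) (-89/64),
           tuple (-1) (-2/3) (247/96) (-89/64)}
    \<and> \<not> PC2"
proof -
  have "Phi (Var v) = Phi_tuple $ v" for v
    by (simp add: Phi_def)
  moreover have "\<not> PC2"
    using poisson_endo_Phi not_algebra_auto_Phi by (auto simp: PC2_def)
  ultimately show ?thesis
    using poisson_endo_Phi not_algebra_auto_Phi det_jacobian_Phi_tuple fibre_Phi
    by (simp add: Phi_tuple_def)
qed

end
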